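(* For a nonempty finite set $Q$ consisting of positive rationals, let $M_Q = \langle q^n : (q,n) \in Q \times \mathbb{N}_0 \rangle$ be the monoid powerly generated by $Q$. The following conditions are equivalent. (a) $M_Q$ is closed under multiplication, which means that $M_Q = \mathbb{N}_0[Q]$. (b) $q^i r^j \in M_Q$ for all $q,r \in Q$ and $i,j \in \mathbb{N}_0$.
   Context: $\langle S \rangle$ denotes the additive submonoid of $\mathbb{Q}_{\ge 0}$ generated by $S$. For $Q = \{q_1, \dots, q_n\}$, $\mathbb{N}_0[Q] = \{f(q_1, \dots, q_n) : f \in \mathbb{N}_0[x_1, \dots, x_n]\}$, where $\mathbb{N}_0[x_1,\dots,x_n]$ is the semiring of polynomials with coefficients in $\mathbb{N}_0 = \{0,1,2,\dots\}$. Multiplication is the standard multiplication of rationals. *)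

theory Defs
  imports Complex_Main "HOL-Library.Poly_Mapping"
begin

definition additive_submonoid :: "rat set \<Rightarrow> bool" where
  "additive_submonoid M \<longleftrightarrow> M \<subseteq> {0..} \<and> 0 \<in> M \<and> (\<forall>x\<in>M. \<forall>y\<in>M. x + y \<in> M)"

definition submonoid_generated :: "rat set \<Rightarrow> rat set" where
  "submonoid_generated S = additive_submonoid hull S"

definition powerly_generated :: "rat set \<Rightarrow> rat set" where
  "powerly_generated Q = submonoid_generated {q ^ n | q n. q \<in> Q}"

text \<open>
  A polynomial with coefficients in \<open>\<nat>\<close> in variables of type \<open>'v\<close> is a finitely supported map
  from monomials to coefficients, a monomial being a finitely supported map from variables to
  exponents.
\<close>

type_synonym 'v nat_mpoly = "('v \<Rightarrow>\<^sub>0 nat) \<Rightarrow>\<^sub>0 nat"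

definition mpolys_in :: "'v set \<Rightarrow> 'v nat_mpoly set" where
  "mpolys_in V = {f. \<forall>m\<in>Poly_Mapping.keys f. Poly_Mapping.keys m \<subseteq> V}"

definition eval_mpoly :: "('v \<Rightarrow> rat) \<Rightarrow> 'v nat_mpoly \<Rightarrow> rat" where
  "eval_mpoly a f =
     (\<Sum>m\<in>Poly_Mapping.keys f. of_nat (Poly_Mapping.lookup f m) *
        (\<Prod>v\<in>Poly_Mapping.keys m. a v ^ Poly_Mapping.lookup m v))"

text \<open>
  The variables are indexed by the elements of \<open>Q\<close> instead of by an enumeration
  \<open>q\<^sub>1, \<dots>, q\<^sub>n\<close> of \<open>Q\<close>; the variable belonging to \<open>q\<close> is evaluated at \<open>q\<close>.
\<close>

definition nat_adjoin :: "rat set \<Rightarrow> rat set" where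
  "nat_adjoin Q = {eval_mpoly (\<lambda>q. q) f | f. f \<in> mpolys_in Q}"

definition closed_under_mult :: "rat set \<Rightarrow> bool" where
  "closed_under_mult M \<longleftrightarrow> (\<forall>x\<in>M. \<forall>y\<in>M. x * y \<in> M)"

end

theory Submission imports Defs begin

text \<open>
  Both equivalences pass through (b). By bilinearity, closure of \<open>M\<^sub>Q\<close> under multiplication can be
  tested on its generators, which is (b). If \<open>M\<^sub>Q\<close> is closed under multiplication then it contains
  all monomials in \<open>Q\<close>, hence \<open>\<nat>\<^sub>0[Q]\<close>, and the reverse inclusion always holds. Conversely
  \<open>\<nat>\<^sub>0[Q]\<close> contains the monomials \<open>q\<^sup>i r\<^sup>j\<close>, so \<open>M\<^sub>Q = \<nat>\<^sub>0[Q]\<close> implies (b).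
\<close>

lemma submonoid_generated_base: "x \<in> S \<Longrightarrow> x \<in> submonoid_generated S"
  unfolding submonoid_generated_def by (rule hull_inc)

text \<open>The empty family is excluded since its intersection is all of \<open>rat\<close>,
  negative numbers included.\<close>

lemma additive_submonoid_Inter:
  assumes "T \<noteq> {}" and "\<And>M. M \<in> T \<Longrightarrow> additive_submonoid M"
  shows "additive_submonoid (\<Inter>T)"
  using assms unfolding additive_submonoid_def by fast

lemma additive_submonoid_submonoid_generated:
  assumes "S \<subseteq> {0..}"
  shows "additive_submonoid (submonoid_generated S)"
proof -
  \<comment> \<open>By the assumption on \<open>S\<close>, this set belongs to the family
    intersected by the hull, so that family is nonempty.\<close>
  have "additive_submonoid {0..}"
    by (simp add: additive_submonoid_def)
  with assms show ?thesis
    unfolding submonoid_generated_def hull_def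
    by (intro additive_submonoid_Inter) auto
qed

lemma submonoid_generated_minimal:
  "S \<subseteq> M \<Longrightarrow> additive_submonoid M \<Longrightarrow> submonoid_generated S \<subseteq> M"
  unfolding submonoid_generated_def by (rule hull_minimal)

lemma closed_under_mult_submonoid_generated_iff:
  assumes "S \<subseteq> {0..}"
  shows "closed_under_mult (submonoid_generated S) \<longleftrightarrow>
    (\<forall>x\<in>S. \<forall>y\<in>S. x * y \<in> submonoid_generated S)"
proof
  assume "closed_under_mult (submonoid_generated S)"
  then show "\<forall>x\<in>S. \<forall>y\<in>S. x * y \<in> submonoid_generated S"
    by (simp add: closed_under_mult_def submonoid_generated_base)
next
  let ?M = "submonoid_generated S"
  assume gen: "\<forall>x\<in>S. \<forall>y\<in>S. x * y \<in> ?M"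
  note M = additive_submonoid_submonoid_generated[OF assms]
  have left: "x * y \<in> ?M" if "x \<in> S" "y \<in> ?M" for x y
  proof -
    \<comment> \<open>Multiplication by \<open>x\<close> is additive, so the right side is a
      submonoid containing \<open>S\<close>. Restricting to \<open>y \<in> ?M\<close> keeps it
      nonnegative even when \<open>x = 0\<close>.\<close>
    have "?M \<subseteq> {y \<in> ?M. x * y \<in> ?M}"
      using gen that(1) M
      by (intro submonoid_generated_minimal)
        (auto simp: additive_submonoid_def distrib_left intro: submonoid_generated_base)
    with that(2) show ?thesis by blast
  qed
  have "x * y \<in> ?M" if "x \<in> ?M" "y \<in> ?M" for x y
  proof -
    \<comment> \<open>The same argument in the first factor; \<open>left\<close> now puts
      \<open>S\<close> into the set for every \<open>y\<close> in \<open>?M\<close>.\<close>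
    have "?M \<subseteq> {x \<in> ?M. x * y \<in> ?M}"
      using left that(2) M
      by (intro submonoid_generated_minimal)
        (auto simp: additive_submonoid_def distrib_right intro: submonoid_generated_base)
    with that(1) show ?thesis by blast
  qed
  then show "closed_under_mult ?M"
    by (simp add: closed_under_mult_def)
qed

lemma additive_submonoid_sum:
  assumes "additive_submonoid M" and "\<And>i. i \<in> A \<Longrightarrow> f i \<in> M"
  shows "sum f A \<in> M"
  using assms by (induction A rule: infinite_finite_induct) (auto simp: additive_submonoid_def)

lemma additive_submonoid_of_nat_mult:
  assumes "additive_submonoid M" and "x \<in> M"
  shows "of_nat n * x \<in> M"
  using assms by (induction n) (auto simp: additive_submonoid_def distrib_right)

lemma closed_under_mult_power:
  assumes "closed_under_mult M" and "1 \<in> M" and "x \<in> M"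
  shows "x ^ n \<in> M"
  using assms by (induction n) (auto simp: closed_under_mult_def)

lemma closed_under_mult_prod:
  assumes "closed_under_mult M" and "1 \<in> M" and "\<And>i. i \<in> A \<Longrightarrow> f i \<in> M"
  shows "prod f A \<in> M"
  using assms by (induction A rule: infinite_finite_induct) (auto simp: closed_under_mult_def)

text \<open>Evaluation uses only powers, products, natural multiples and sums, each of which stays
  in \<open>M\<close>; \<open>1 \<in> M\<close> covers exponent 0 and the empty product.\<close>

lemma eval_mpoly_in:
  assumes "additive_submonoid M" and "closed_under_mult M" and "1 \<in> M"
    and "f \<in> mpolys_in V" and "\<And>v. v \<in> V \<Longrightarrow> a v \<in> M"
  shows "eval_mpoly a f \<in> M"
  unfolding eval_mpoly_def using assms
  by (intro additive_submonoid_sum additive_submonoid_of_nat_mult closed_under_mult_prod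
      closed_under_mult_power) (auto simp: mpolys_in_def)

text \<open>The additional terms have coefficient 0. This allows \<open>f\<close>, \<open>g\<close>
  and \<open>f + g\<close> to be summed over one index set.\<close>

lemma eval_mpoly_superset:
  assumes "finite A" and "Poly_Mapping.keys f \<subseteq> A"
  shows "eval_mpoly a f = (\<Sum>m\<in>A. of_nat (Poly_Mapping.lookup f m) *
    (\<Prod>v\<in>Poly_Mapping.keys m. a v ^ Poly_Mapping.lookup m v))"
  unfolding eval_mpoly_def using assms
  by (intro sum.mono_neutral_left) (auto simp: in_keys_iff)

lemma eval_mpoly_add: "eval_mpoly a (f + g) = eval_mpoly a f + eval_mpoly a g"
proof -
  let ?A = "Poly_Mapping.keys f \<union> Poly_Mapping.keys g"
  have "Poly_Mapping.keys (f + g) \<subseteq> ?A"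
    by (rule Poly_Mapping.keys_add)
  then show ?thesis
    by (simp add: eval_mpoly_superset[of ?A] lookup_add distrib_right sum.distrib)
qed

lemma eval_mpoly_nonneg:
  assumes "f \<in> mpolys_in V" and "\<And>v. v \<in> V \<Longrightarrow> 0 \<le> a v"
  shows "0 \<le> eval_mpoly a f"
  unfolding eval_mpoly_def using assms
  by (intro sum_nonneg mult_nonneg_nonneg prod_nonneg zero_le_power) (auto simp: mpolys_in_def)

lemma additive_submonoid_nat_adjoin:
  assumes "\<forall>q\<in>Q. 0 \<le> q"
  shows "additive_submonoid (nat_adjoin Q)"
proof -
  have "nat_adjoin Q \<subseteq> {0..}"
    using assms by (auto simp: nat_adjoin_def intro: eval_mpoly_nonneg)
  moreover have "0 \<in> nat_adjoin Q"
    unfolding nat_adjoin_def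
    by (rule CollectI, rule exI[of _ 0]) (simp add: eval_mpoly_def mpolys_in_def)
  moreover have "x + y \<in> nat_adjoin Q" if "x \<in> nat_adjoin Q" "y \<in> nat_adjoin Q" for x y
  proof -
    from that obtain f g where fg: "f \<in> mpolys_in Q" "g \<in> mpolys_in Q"
      "x = eval_mpoly (\<lambda>q. q) f" "y = eval_mpoly (\<lambda>q. q) g"
      by (auto simp: nat_adjoin_def)
    have "f + g \<in> mpolys_in Q"
      using fg(1,2) Poly_Mapping.keys_add[of f g] by (fastforce simp: mpolys_in_def)
    with fg(3,4) show ?thesis
      by (auto simp: nat_adjoin_def eval_mpoly_add[symmetric])
  qed
  ultimately show ?thesis
    by (simp add: additive_submonoid_def)
qed

text \<open>Monomials are written additively, so this is multiplicativity of their evaluation. Over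
  the common index set \<open>?A\<close> the additional factors are
  \<open>a v ^ 0 = 1\<close>.\<close>

lemma prod_power_lookup_add:
  fixes a :: "'v \<Rightarrow> 'a::comm_semiring_1"
  shows "(\<Prod>v\<in>Poly_Mapping.keys (m + n). a v ^ Poly_Mapping.lookup (m + n) v) =
    (\<Prod>v\<in>Poly_Mapping.keys m. a v ^ Poly_Mapping.lookup m v) *
    (\<Prod>v\<in>Poly_Mapping.keys n. a v ^ Poly_Mapping.lookup n v)"
proof -
  let ?A = "Poly_Mapping.keys m \<union> Poly_Mapping.keys n"
  have superset: "(\<Prod>v\<in>Poly_Mapping.keys k. a v ^ Poly_Mapping.lookup k v) =
      (\<Prod>v\<in>?A. a v ^ Poly_Mapping.lookup k v)"
    if "Poly_Mapping.keys k \<subseteq> ?A" for k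
    using that by (intro prod.mono_neutral_left) (auto simp: in_keys_iff)
  show ?thesis
    unfolding superset[OF Poly_Mapping.keys_add] superset[OF Un_upper1] superset[OF Un_upper2]
    by (simp add: lookup_add power_add prod.distrib)
qed

lemma power_mult_power_in_nat_adjoin:
  assumes "q \<in> Q" and "r \<in> Q"
  shows "q ^ i * r ^ j \<in> nat_adjoin Q"
proof -
  \<comment> \<open>Taking a sum treats \<open>q = r\<close> uniformly, as the exponents then add
    up. A zero exponent makes its summand the empty monomial, with value 1.\<close>
  let ?m = "Poly_Mapping.single q i + Poly_Mapping.single r j"
  have "Poly_Mapping.keys ?m \<subseteq> Q"
    using Poly_Mapping.keys_add[of "Poly_Mapping.single q i" "Poly_Mapping.single r j"] assms
    by (auto split: if_splits)
  then have "Poly_Mapping.single ?m 1 \<in> mpolys_in Q"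
    by (simp add: mpolys_in_def)
  moreover have "eval_mpoly (\<lambda>q. q) (Poly_Mapping.single ?m 1) = q ^ i * r ^ j"
    by (simp add: eval_mpoly_def prod_power_lookup_add)
  ultimately show ?thesis
    unfolding nat_adjoin_def by (metis (mono_tags, lifting) CollectI)
qed

lemma power_in_powerly_generated: "q \<in> Q \<Longrightarrow> q ^ n \<in> powerly_generated Q"
  unfolding powerly_generated_def by (rule submonoid_generated_base) blast

lemma powerly_generated_subset_nat_adjoin:
  assumes "\<forall>q\<in>Q. 0 \<le> q"
  shows "powerly_generated Q \<subseteq> nat_adjoin Q"
  unfolding powerly_generated_def
proof (rule submonoid_generated_minimal)
  show "{q ^ n | q n. q \<in> Q} \<subseteq> nat_adjoin Q"
    \<comment> \<open>With exponent 0 the second factor is 1, leaving a pure power.\<close>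
    using power_mult_power_in_nat_adjoin[where j = 0] by fastforce
qed (rule additive_submonoid_nat_adjoin[OF assms])

theorem proposition6p5:
  fixes Q :: "rat set"
  assumes "finite Q" and "Q \<noteq> {}" and "\<forall>q\<in>Q. 0 < q"
  shows "(closed_under_mult (powerly_generated Q) \<longleftrightarrow> powerly_generated Q = nat_adjoin Q) \<and>
         (closed_under_mult (powerly_generated Q) \<longleftrightarrow>
           (\<forall>q\<in>Q. \<forall>r\<in>Q. \<forall>i j :: nat. q ^ i * r ^ j \<in> powerly_generated Q))"
proof -
  let ?M = "powerly_generated Q"
  have nonneg: "\<forall>q\<in>Q. 0 \<le> q"
    using assms(3) by (simp add: less_imp_le)
  then have gens: "{q ^ n | q n. q \<in> Q} \<subseteq> {0..}"
    by auto
  have b: "closed_under_mult ?M \<longleftrightarrow> (\<forall>q\<in>Q. \<forall>r\<in>Q. \<forall>i j :: nat. q ^ i * r ^ j \<in> ?M)"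
    unfolding powerly_generated_def closed_under_mult_submonoid_generated_iff[OF gens]
    by blast
  \<comment> \<open>Any \<open>q\<close> in the nonempty set \<open>Q\<close> gives the generator
    \<open>q ^ 0 = 1\<close>.\<close>
  have one: "1 \<in> ?M"
    using assms(2) power_in_powerly_generated[where n = 0] by auto
  have "nat_adjoin Q \<subseteq> ?M" if "closed_under_mult ?M"
  proof -
    have "additive_submonoid ?M"
      unfolding powerly_generated_def by (rule additive_submonoid_submonoid_generated[OF gens])
    with that one show ?thesis
      using power_in_powerly_generated[where n = 1]
      by (auto simp: nat_adjoin_def intro: eval_mpoly_in)
  qed
  with powerly_generated_subset_nat_adjoin[OF nonneg]
  have "closed_under_mult ?M \<Longrightarrow> ?M = nat_adjoin Q"
    by blast
  \<comment> \<open>Through \<open>b\<close> only products of two powers have to be checked, which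
    avoids multiplying general polynomials.\<close>
  moreover have "closed_under_mult ?M" if "?M = nat_adjoin Q"
    unfolding b using that power_mult_power_in_nat_adjoin by blast
  ultimately show ?thesis
    using b by blast
qed

end
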